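(* If $D$ is a finite $2$-semi-symmetric digraph, then $D$ is $\alpha$-diperfect.
   Context: Digraphs have no loops and no parallel arcs, but may contain both arcs $uv$ and $vu$ (cycles of length two). Two vertices $u,v$ are adjacent if $uv$ or $vu$ is an arc. An arc $uv$ of $D$ is lonely if $vu\notin A(D)$. A digraph is $k$-semi-symmetric if it has at most $k$ lonely arcs. A stable set is a set of pairwise non-adjacent vertices; it is maximum if no stable set has larger cardinality. A path of $D$ is a directed path, i.e. a sequence $v_1v_2\cdots v_\ell$ of distinct vertices ($\ell\ge 1$) with $v_iv_{i+1}\in A(D)$ for $1\le i<\ell$. A path partition of $D$ is a collection of paths whose vertex sets partition $V(D)$. For a stable set $S$, an $S$-path partition of $D$ is a path partition $\mathcal P$ with $|V(P)\cap S|=1$ for all $P\in\mathcal P$. A digraph satisfies the $\alpha$-property if it has an $S$-path partition for every maximum stable set $S$. A digraph is $\alpha$-diperfect if every induced subdigraph of it satisfies the $\alpha$-property. *)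

theory Defs
  imports "Graph_Theory.Graph_Theory" "HOL-Library.Disjoint_Sets"
begin

definition adjacent :: "('a, 'b) pre_digraph \<Rightarrow> 'a \<Rightarrow> 'a \<Rightarrow> bool" where
  "adjacent D u v \<longleftrightarrow> (u, v) \<in> arcs_ends D \<or> (v, u) \<in> arcs_ends D"

definition lonely_arcs :: "('a, 'b) pre_digraph \<Rightarrow> 'b set" where
  "lonely_arcs D = {e \<in> arcs D. (head D e, tail D e) \<notin> arcs_ends D}"

definition semi_symmetric :: "nat \<Rightarrow> ('a, 'b) pre_digraph \<Rightarrow> bool" where
  "semi_symmetric k D \<longleftrightarrow> finite (lonely_arcs D) \<and> card (lonely_arcs D) \<le> k"

definition stable_set :: "('a, 'b) pre_digraph \<Rightarrow> 'a set \<Rightarrow> bool" where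
  "stable_set D S \<longleftrightarrow> S \<subseteq> verts D \<and> pairwise (\<lambda>u v. \<not> adjacent D u v) S"

(* Cardinalities are compared by card, so this and the notions built on it are
   only meaningful for finite digraphs. *)
definition maximum_stable_set :: "('a, 'b) pre_digraph \<Rightarrow> 'a set \<Rightarrow> bool" where
  "maximum_stable_set D S \<longleftrightarrow> stable_set D S \<and> (\<forall>T. stable_set D T \<longrightarrow> card T \<le> card S)"

(* Paths are nonempty lists of distinct vertices (vpath). The family set is indexed by
   the paths themselves, so different paths in P have disjoint vertex sets. *)
definition path_partition :: "('a, 'b) pre_digraph \<Rightarrow> 'a list set \<Rightarrow> bool" where
  "path_partition D P \<longleftrightarrow>
     (\<forall>p\<in>P. vpath p D) \<and> disjoint_family_on set P \<and> (\<Union>p\<in>P. set p) = verts D"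

definition S_path_partition :: "('a, 'b) pre_digraph \<Rightarrow> 'a set \<Rightarrow> 'a list set \<Rightarrow> bool" where
  "S_path_partition D S P \<longleftrightarrow> path_partition D P \<and> (\<forall>p\<in>P. card (set p \<inter> S) = 1)"

definition alpha_property :: "('a, 'b) pre_digraph \<Rightarrow> bool" where
  "alpha_property D \<longleftrightarrow> (\<forall>S. maximum_stable_set D S \<longrightarrow> (\<exists>P. S_path_partition D S P))"

definition alpha_diperfect :: "('a, 'b) pre_digraph \<Rightarrow> bool" where
  "alpha_diperfect D \<longleftrightarrow> (\<forall>H. induced_subgraph H D \<longrightarrow> alpha_property H)"

end

theory Submission
  imports Defs
begin

text \<open>
  Everything rests on the theorem of Gallai and Milgram: the vertices of a finite relation can
  be partitioned into at most \<open>\<alpha>\<close> directed paths, where \<open>\<alpha>\<close> is the largest size of a stable set.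
  Given a maximum stable set \<open>S\<close> of a digraph \<open>D\<close>, choose a relation \<open>R\<close> that has the same
  adjacencies as \<open>D\<close> but no arc into \<open>S\<close>. Since \<open>R\<close> has the same stable sets, there is a
  partition into at most \<open>|S|\<close> paths of \<open>R\<close>. A vertex of \<open>S\<close> can only be the first one of its
  path, so there are exactly \<open>|S|\<close> paths and each of them starts in \<open>S\<close> and avoids \<open>S\<close> from then
  on. It remains to choose \<open>R\<close> such that every such path, read forwards or backwards, is a path
  of \<open>D\<close> (\<open>S_path_partition_if_sources\<close>).

  If no lonely arc enters \<open>S\<close>, deleting from \<open>D\<close> all arcs into \<open>S\<close> keeps all adjacencies and
  gives such an \<open>R\<close>. If no lonely arc leaves \<open>S\<close>, the same works after reversing all arcs of \<open>D\<close>.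
  Otherwise one of the at most two lonely arcs enters \<open>S\<close> and the other one leaves \<open>S\<close>, so \<open>D\<close> is
  symmetric outside \<open>S\<close>. Then let \<open>R\<close> consist of both orientations of all arcs, except those
  into \<open>S\<close>: on a path of \<open>R\<close> that starts in \<open>S\<close> only the first step can fail to be an arc of
  \<open>D\<close>, and if it does, the reversed path is a path of \<open>D\<close>.

  The hypothesis passes to induced subdigraphs, because an arc of an induced subdigraph is
  lonely there only if it is lonely in \<open>D\<close>.
\<close>

section \<open>The theorem of Gallai and Milgram\<close>

text \<open>
  Paths are taken in an arbitrary relation and not in a digraph, because they will be needed for
  relations that contain reversed arcs of the given digraph.
\<close>

definition path_cover :: "('a \<Rightarrow> 'a \<Rightarrow> bool) \<Rightarrow> 'a set \<Rightarrow> 'a list set \<Rightarrow> bool" where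
  "path_cover R V P \<longleftrightarrow>
     (\<forall>p\<in>P. p \<noteq> [] \<and> distinct p \<and> successively R p) \<and>
     disjoint_family_on set P \<and> (\<Union>p\<in>P. set p) = V"

lemma path_cover_insert:
  assumes "path_cover R V P" "q \<noteq> []" "distinct q" "successively R q" "set q \<inter> V = {}"
  shows "path_cover R (V \<union> set q) (insert q P)"
  using assms unfolding path_cover_def disjoint_family_on_def by auto

lemma path_cover_remove:
  assumes "path_cover R V P" "p \<in> P"
  shows "path_cover R (V - set p) (P - {p})"
  using assms unfolding path_cover_def disjoint_family_on_def by blast

lemma path_cover_unique:
  assumes "path_cover R V P" "p \<in> P" "q \<in> P" "x \<in> set p" "x \<in> set q"
  shows "p = q"
  using assms unfolding path_cover_def disjoint_family_on_def by blast

lemma inj_on_last_path_cover: "path_cover R V P \<Longrightarrow> inj_on last P"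
  by (rule inj_onI) (metis last_in_set path_cover_def path_cover_unique)

lemma last_image_remove:
  assumes "path_cover R V P" "p \<in> P"
  shows "last ` (P - {p}) = last ` P - {last p}"
  using inj_on_image_set_diff[OF inj_on_last_path_cover[OF assms(1)], of P "{p}"] assms(2) by simp

text \<open>
  The Gallai--Milgram argument only ever looks at the set of last vertices of a path partition;
  the three operations on partitions that it uses are stated in terms of this set.
\<close>

definition end_set :: "('a \<Rightarrow> 'a \<Rightarrow> bool) \<Rightarrow> 'a set \<Rightarrow> 'a set \<Rightarrow> bool" where
  "end_set R V X \<longleftrightarrow> (\<exists>P. path_cover R V P \<and> last ` P = X)"

lemma end_set_subset: "end_set R V X \<Longrightarrow> X \<subseteq> V"
  unfolding end_set_def path_cover_def by auto

lemma end_set_singleton_path: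
  assumes "end_set R V X" "v \<notin> V"
  shows "end_set R (insert v V) (insert v X)"
proof -
  from assms(1) obtain P where P: "path_cover R V P" "last ` P = X"
    unfolding end_set_def by blast
  have "path_cover R (V \<union> set [v]) (insert [v] P)"
    using P(1) assms(2) by (intro path_cover_insert) auto
  with P(2) show ?thesis unfolding end_set_def by (intro exI[of _ "insert [v] P"]) auto
qed

lemma end_set_extend_path:
  assumes "end_set R V X" "v \<notin> V" "w \<in> X" "R w v"
  shows "end_set R (insert v V) (insert v (X - {w}))"
proof -
  from assms(1) obtain P where P: "path_cover R V P" "last ` P = X"
    unfolding end_set_def by blast
  with assms(3) obtain p where p: "p \<in> P" "last p = w" by blast
  have p': "p \<noteq> []" "distinct p" "successively R p" "set p \<subseteq> V"
    using P(1) p(1) unfolding path_cover_def by auto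
  have "path_cover R ((V - set p) \<union> set (p @ [v])) (insert (p @ [v]) (P - {p}))"
    using path_cover_remove[OF P(1) p(1)] p' p(2) assms(2,4)
    by (intro path_cover_insert) (auto simp: successively_append_iff)
  moreover have "(V - set p) \<union> set (p @ [v]) = insert v V" using p'(4) by auto
  moreover have "last ` insert (p @ [v]) (P - {p}) = insert v (X - {w})"
    using last_image_remove[OF P(1) p(1)] P(2) p(2) by simp
  ultimately show ?thesis unfolding end_set_def by metis
qed

lemma end_set_remove_end:
  assumes "end_set R V X" "v \<in> X"
  obtains "end_set R (V - {v}) (X - {v})"
  | w where "R w v" "w \<notin> X" "end_set R (V - {v}) (insert w (X - {v}))"
proof -
  from assms(1) obtain P where P: "path_cover R V P" "last ` P = X"
    unfolding end_set_def by blast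
  with assms(2) obtain p where p: "p \<in> P" "last p = v" by blast
  have p': "p \<noteq> []" "distinct p" "successively R p" "set p \<subseteq> V"
    using P(1) p(1) unfolding path_cover_def by auto
  have rem: "path_cover R (V - set p) (P - {p})" by (rule path_cover_remove[OF P(1) p(1)])
  have ends: "last ` (P - {p}) = X - {v}"
    using last_image_remove[OF P(1) p(1)] P(2) p(2) by simp
  obtain q where q: "p = q @ [v]" using p'(1) p(2) by (metis append_butlast_last_id)
  show thesis
  proof (cases "q = []")
    case True
    with rem ends q show thesis using that(1) unfolding end_set_def by auto
  next
    case False
    have "path_cover R ((V - set p) \<union> set q) (insert q (P - {p}))"
      using rem p' q False by (intro path_cover_insert) (auto simp: successively_append_iff)
    moreover have "(V - set p) \<union> set q = V - {v}" using p' q by auto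
    moreover have "last ` insert q (P - {p}) = insert (last q) (X - {v})" using ends by simp
    ultimately have "end_set R (V - {v}) (insert (last q) (X - {v}))"
      unfolding end_set_def by metis
    moreover have "R (last q) v" using p'(3) q False by (simp add: successively_append_iff)
    moreover have "last q \<notin> X"
    proof
      assume "last q \<in> X"
      then obtain r where r: "r \<in> P" "last r = last q" using P(2) by auto
      moreover have "r \<noteq> []" using P(1) r(1) unfolding path_cover_def by blast
      ultimately have "r = p"
        using path_cover_unique[OF P(1) r(1) p(1), of "last q"] last_in_set[of r]
          last_in_set[OF False] q by simp
      with r(2) p(2) have "v = last q" by simp
      with p'(2) q last_in_set[OF False] show False by simp
    qed
    ultimately show thesis using that(2) by blast
  qed
qed

text \<open>
  Suppose that \<open>X\<close> is not stable, say \<open>R u v\<close> with \<open>u\<close> and \<open>v\<close> in \<open>X\<close>. If \<open>v\<close> alone is a path, it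
  can be appended to the path that ends in \<open>u\<close>, and \<open>u\<close> is no longer an end. Otherwise remove
  \<open>v\<close>, so that its predecessor \<open>w\<close> becomes an end, and apply induction. When this makes the end
  set smaller, put \<open>v\<close> back behind \<open>w\<close> if \<open>w\<close> is still an end, else behind \<open>u\<close> if \<open>u\<close> is still an
  end, else as a path of its own. In each case a vertex is lost from \<open>X\<close>.
\<close>

lemma stable_or_smaller_end_set:
  assumes "finite V" "end_set R V X"
  shows "(\<exists>T\<subseteq>V. pairwise (\<lambda>u v. \<not> R u v) T \<and> card T = card X) \<or> (\<exists>Y. end_set R V Y \<and> Y \<subset> X)"
  using assms
proof (induction V arbitrary: X rule: finite_psubset_induct)
  case (psubset V)
  note XV = end_set_subset[OF psubset.prems]
  show ?case
  proof (cases "pairwise (\<lambda>u v. \<not> R u v) X")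
    case True
    with XV show ?thesis by blast
  next
    case False
    then obtain u v where uv: "u \<in> X" "v \<in> X" "u \<noteq> v" "R u v" unfolding pairwise_def by blast
    have V: "insert v (V - {v}) = V" "v \<notin> V - {v}" using uv(2) XV by auto
    from psubset.prems uv(2) show ?thesis
    proof (cases rule: end_set_remove_end)
      case 1
      from end_set_extend_path[OF this V(2), of u] uv
      have "end_set R V (insert v (X - {v} - {u}))" by (simp only: V) simp
      moreover have "insert v (X - {v} - {u}) \<subset> X" using uv by auto
      ultimately show ?thesis by blast
    next
      case (2 w)
      have "finite X" using XV psubset.hyps finite_subset by blast
      then have card: "card (insert w (X - {v})) = card X"
        using 2(2) card.remove[OF \<open>finite X\<close> uv(2)] by (simp del: card_Diff_singleton)
      have "V - {v} \<subset> V" using uv(2) XV by auto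
      from psubset.IH[OF this 2(3)] show ?thesis
      proof (elim disjE exE conjE)
        fix T
        assume "T \<subseteq> V - {v}" "pairwise (\<lambda>u v. \<not> R u v) T" "card T = card (insert w (X - {v}))"
        with card show ?thesis by auto
      next
        fix Y assume Y: "end_set R (V - {v}) Y" "Y \<subset> insert w (X - {v})"
        consider "w \<in> Y" | "w \<notin> Y" "u \<in> Y" | "w \<notin> Y" "u \<notin> Y" by blast
        then have "\<exists>Z. end_set R V Z \<and> Z \<subset> X"
        proof cases
          case 1
          have "end_set R V (insert v (Y - {w}))"
            using end_set_extend_path[OF Y(1) V(2) 1 2(1)] by (simp only: V)
          moreover have "insert v (Y - {w}) \<subset> X"
            using Y(2) 1 uv(2) 2(2) by blast
          ultimately show ?thesis by blast
        next
          case 2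
          have "end_set R V (insert v (Y - {u}))"
            using end_set_extend_path[OF Y(1) V(2) 2(2) uv(4)] by (simp only: V)
          moreover have "insert v (Y - {u}) \<subset> X"
            using Y(2) 2 uv by blast
          ultimately show ?thesis by blast
        next
          case 3
          have "end_set R V (insert v Y)"
            using end_set_singleton_path[OF Y(1) V(2)] by (simp only: V)
          moreover have "insert v Y \<subset> X"
            using Y(2) 3 uv by blast
          ultimately show ?thesis by blast
        qed
        then show ?thesis ..
      qed
    qed
  qed
qed

theorem gallai_milgram:
  assumes "finite V"
  obtains P T where "path_cover R V P" "T \<subseteq> V" "pairwise (\<lambda>u v. \<not> R u v) T" "card P \<le> card T"
proof -
  have "path_cover R V ((\<lambda>v. [v]) ` V)"
    unfolding path_cover_def disjoint_family_on_def by auto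
  then have "\<exists>X. end_set R V X" unfolding end_set_def by blast
  \<comment> \<open>A path partition with an inclusion-minimal end set leaves only the stable alternative.\<close>
  moreover have "finite {X. end_set R V X}"
  proof (rule finite_subset)
    show "{X. end_set R V X} \<subseteq> Pow V" using end_set_subset[of R V] by blast
  qed (use assms in simp)
  ultimately obtain X where X: "end_set R V X" "\<And>Y. end_set R V Y \<Longrightarrow> \<not> Y \<subset> X"
    using finite_has_minimal[of "{X. end_set R V X}"] by auto
  from X(1) obtain P where P: "path_cover R V P" "last ` P = X" unfolding end_set_def by blast
  from stable_or_smaller_end_set[OF assms X(1)] X(2)
  obtain T where T: "T \<subseteq> V" "pairwise (\<lambda>u v. \<not> R u v) T" "card T = card X" by blast
  have "card P = card X"
    using card_image[OF inj_on_last_path_cover[OF P(1)]] P(2) by simp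
  with P T that show thesis by simp
qed

section \<open>Path partitions in which a maximum stable set consists of sources\<close>

lemma hd_if_no_predecessor:
  "successively R p \<Longrightarrow> x \<in> set p \<Longrightarrow> (\<And>y. \<not> R y x) \<Longrightarrow> x = hd p"
  by (induction p rule: induct_list012) auto

lemma set_vwalk_arcs_subset_iff:
  "set (vwalk_arcs p) \<subseteq> A \<longleftrightarrow> successively (\<lambda>u v. (u, v) \<in> A) p"
  by (induction p rule: vwalk_arcs.induct) auto

text \<open>
  The sources of \<open>R\<close> in \<open>S\<close> can only be first vertices, and by maximality of \<open>S\<close> there are at most
  \<open>|S|\<close> paths of \<open>R\<close>; hence every path starts in \<open>S\<close>. Reversing some of the paths changes
  neither their vertex sets nor the fact that these partition the vertices.
\<close>

lemma S_path_partition_if_sources: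
  assumes fin: "finite (verts D)" and S: "maximum_stable_set D S"
    and adj: "\<And>u v. adjacent D u v \<Longrightarrow> R u v \<or> R v u"
    and source: "\<And>u v. v \<in> S \<Longrightarrow> \<not> R u v"
    and orient: "\<And>p. \<lbrakk>p \<noteq> []; successively R p; hd p \<in> S; set (tl p) \<inter> S = {}\<rbrakk> \<Longrightarrow>
      \<exists>q\<in>{p, rev p}. successively (\<lambda>u v. (u, v) \<in> arcs_ends D) q"
  shows "\<exists>P. S_path_partition D S P"
proof -
  obtain P T where P: "path_cover R (verts D) P" and T: "T \<subseteq> verts D"
      "pairwise (\<lambda>u v. \<not> R u v) T" and le: "card P \<le> card T"
    using gallai_milgram[OF fin] .
  have path: "p \<noteq> []" "distinct p" "successively R p" "set p \<subseteq> verts D" if "p \<in> P" for p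
    using P that unfolding path_cover_def by auto
  have union: "(\<Union>p\<in>P. set p) = verts D" using P unfolding path_cover_def by simp
  have "\<not> adjacent D u v" if "u \<in> T" "v \<in> T" "u \<noteq> v" for u v
    using pairwiseD[OF T(2), of u v] pairwiseD[OF T(2), of v u] that adj[of u v] by blast
  with T(1) have "stable_set D T"
    unfolding stable_set_def by (intro conjI pairwiseI)
  then have "card T \<le> card S" using S unfolding maximum_stable_set_def by blast
  with le have "card P \<le> card S" by simp
  moreover have "finite P"
  proof (rule finite_imageD)
    show "finite (last ` P)"
    proof (rule finite_subset[OF _ fin])
      show "last ` P \<subseteq> verts D" using path(1,4) by fastforce
    qed
  qed (rule inj_on_last_path_cover[OF P])
  moreover have "S \<subseteq> hd ` P"
  proof
    fix s assume "s \<in> S"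
    then have "s \<in> verts D" using S unfolding maximum_stable_set_def stable_set_def by blast
    then obtain p where p: "p \<in> P" "s \<in> set p" using union by blast
    have "s = hd p"
      using hd_if_no_predecessor[OF path(3)[OF p(1)] p(2)] source[OF \<open>s \<in> S\<close>] by simp
    with p(1) show "s \<in> hd ` P" by simp
  qed
  ultimately have heads: "hd ` P = S"
    using card_seteq[of "hd ` P" S] card_image_le[of P hd] by (metis finite_imageI le_trans)
  have meet: "set p \<inter> S = {hd p}" if "p \<in> P" for p
  proof
    show "set p \<inter> S \<subseteq> {hd p}"
      using hd_if_no_predecessor[OF path(3)[OF that]] source by auto
    show "{hd p} \<subseteq> set p \<inter> S" using heads that path(1)[OF that] by auto
  qed
  have "\<exists>q. set q = set p \<and> distinct q \<and> successively (\<lambda>u v. (u, v) \<in> arcs_ends D) q"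
    if p: "p \<in> P" for p
  proof -
    have "hd p \<notin> set (tl p)" using path(1,2)[OF p] by (cases p) auto
    moreover have "set (tl p) \<inter> S \<subseteq> {hd p}"
      unfolding meet[OF p, symmetric] using path(1)[OF p] by (auto intro: list.set_sel(2))
    ultimately have "set (tl p) \<inter> S = {}" by blast
    moreover have "hd p \<in> S" using meet[OF p] by blast
    ultimately obtain q where "q \<in> {p, rev p}" "successively (\<lambda>u v. (u, v) \<in> arcs_ends D) q"
      using orient path(1,3)[OF p] by blast
    then show ?thesis using path(2)[OF p] by (intro exI[of _ q]) auto
  qed
  then obtain f where f: "\<And>p. p \<in> P \<Longrightarrow> set (f p) = set p \<and> distinct (f p) \<and>
      successively (\<lambda>u v. (u, v) \<in> arcs_ends D) (f p)"
    by metis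
  have "S_path_partition D S (f ` P)"
    unfolding S_path_partition_def path_partition_def
  proof (intro conjI ballI)
    fix q assume "q \<in> f ` P"
    then obtain p where p: "p \<in> P" "q = f p" by blast
    have "q \<noteq> []" using f[OF p(1)] path(1)[OF p(1)] p(2) by auto
    then show "vpath q D"
      using f[OF p(1)] path(4)[OF p(1)] p(2)
      by (auto simp: vpath_def vwalk_def set_vwalk_arcs_subset_iff)
    show "card (set q \<inter> S) = 1" using f[OF p(1)] meet[OF p(1)] p(2) by simp
  next
    show "disjoint_family_on set (f ` P)"
      unfolding disjoint_family_on_def
    proof (intro ballI impI)
      fix q q' assume "q \<in> f ` P" "q' \<in> f ` P" "q \<noteq> q'"
      then obtain p p' where p: "p \<in> P" "p' \<in> P" "p \<noteq> p'" "q = f p" "q' = f p'" by blast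
      then have "set p \<inter> set p' = {}" using path_cover_unique[OF P p(1,2)] by blast
      with p f show "set q \<inter> set q' = {}" by simp
    qed
    show "(\<Union>q\<in>f ` P. set q) = verts D" unfolding union[symmetric] using f by simp
  qed
  then show ?thesis ..
qed

section \<open>Choosing the sources when there are at most two lonely arcs\<close>

lemma semi_symmetric_induced_subgraph:
  assumes "induced_subgraph H D" "semi_symmetric k D"
  shows "semi_symmetric k H"
proof -
  have "lonely_arcs H \<subseteq> lonely_arcs D"
    using assms(1)
    unfolding lonely_arcs_def induced_subgraph_def subgraph_def compatible_def arcs_ends_conv
    by auto
  with assms(2) show ?thesis
    unfolding semi_symmetric_def by (meson card_mono finite_subset le_trans)
qed

lemma lonely_arcE:
  assumes "(u, v) \<in> arcs_ends D" "(v, u) \<notin> arcs_ends D"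
  obtains e where "e \<in> lonely_arcs D" "tail D e = u" "head D e = v"
  using assms unfolding lonely_arcs_def arcs_ends_conv by auto

text \<open>
  A lonely arc into \<open>S\<close> and a lonely arc out of \<open>S\<close> are different, because no arc joins two
  different vertices of \<open>S\<close> and a loop is never lonely; a lonely arc outside \<open>S\<close> would be a
  third one.
\<close>

lemma symmetric_outside_stable_set:
  assumes semi: "semi_symmetric 2 D" and S: "stable_set D S"
    and enter: "(a, s) \<in> arcs_ends D" "(s, a) \<notin> arcs_ends D" "s \<in> S"
    and leave: "(t, b) \<in> arcs_ends D" "(b, t) \<notin> arcs_ends D" "t \<in> S"
    and uv: "(u, v) \<in> arcs_ends D" "u \<notin> S" "v \<notin> S"
  shows "(v, u) \<in> arcs_ends D"
proof (rule ccontr)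
  assume "(v, u) \<notin> arcs_ends D"
  with uv(1) obtain e1 where e1: "e1 \<in> lonely_arcs D" "tail D e1 = u" "head D e1 = v"
    by (rule lonely_arcE)
  from enter(1,2) obtain e2 where e2: "e2 \<in> lonely_arcs D" "tail D e2 = a" "head D e2 = s"
    by (rule lonely_arcE)
  from leave(1,2) obtain e3 where e3: "e3 \<in> lonely_arcs D" "tail D e3 = t" "head D e3 = b"
    by (rule lonely_arcE)
  have "a \<noteq> s"
    using enter(1,2) by auto
  with S enter have "a \<notin> S"
    unfolding stable_set_def adjacent_def pairwise_def by blast
  then have "e1 \<noteq> e2" "e1 \<noteq> e3" "e2 \<noteq> e3" using e1 e2 e3 uv enter(3) leave(3) by metis+
  then have "card {e1, e2, e3} = 3" by simp
  moreover have "card {e1, e2, e3} \<le> card (lonely_arcs D)"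
    using semi e1 e2 e3 unfolding semi_symmetric_def by (intro card_mono) auto
  ultimately show False using semi unfolding semi_symmetric_def by simp
qed

lemma alpha_property_if_semi_symmetric_2:
  assumes D: "digraph D" and semi: "semi_symmetric 2 D"
  shows "alpha_property D"
  unfolding alpha_property_def
proof (intro allI impI)
  fix S assume S: "maximum_stable_set D S"
  interpret digraph D by (rule D)
  let ?A = "\<lambda>u v. (u, v) \<in> arcs_ends D"
  have stable: "stable_set D S" using S unfolding maximum_stable_set_def by simp
  have outside: "u \<notin> S \<or> v \<notin> S" if "adjacent D u v" for u v
  proof -
    have "u \<noteq> v" using that no_loops unfolding adjacent_def arcs_ends_conv by auto
    with that stable show ?thesis unfolding stable_set_def pairwise_def by blast
  qed
  consider (none_enters) "\<And>u v. ?A u v \<Longrightarrow> v \<in> S \<Longrightarrow> ?A v u"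
    | (none_leaves) "\<And>u v. ?A u v \<Longrightarrow> u \<in> S \<Longrightarrow> ?A v u"
    | (both) a s t b where "?A a s" "\<not> ?A s a" "s \<in> S" "?A t b" "\<not> ?A b t" "t \<in> S"
    by blast
  then show "\<exists>P. S_path_partition D S P"
  proof cases
    case none_enters
    show ?thesis
    proof (rule S_path_partition_if_sources[OF finite_verts S, where R = "\<lambda>u v. ?A u v \<and> v \<notin> S"])
      fix p assume "successively (\<lambda>u v. ?A u v \<and> v \<notin> S) p"
      then have "successively ?A p" by (rule successively_mono) simp
      then show "\<exists>q\<in>{p, rev p}. successively ?A q" by simp
    qed (use none_enters outside in \<open>unfold adjacent_def, blast+\<close>)
  next
    case none_leaves
    show ?thesis
    proof (rule S_path_partition_if_sources[OF finite_verts S, where R = "\<lambda>u v. ?A v u \<and> v \<notin> S"])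
      fix p assume "successively (\<lambda>u v. ?A v u \<and> v \<notin> S) p"
      then have "successively (\<lambda>u v. ?A v u) p" by (rule successively_mono) simp
      then show "\<exists>q\<in>{p, rev p}. successively ?A q" by simp
    qed (use none_leaves outside in \<open>unfold adjacent_def, blast+\<close>)
  next
    case both
    have sym: "?A v u" if "?A u v" "u \<notin> S" "v \<notin> S" for u v
      using symmetric_outside_stable_set[OF semi stable both that] .
    show ?thesis
    proof (rule S_path_partition_if_sources[OF finite_verts S,
          where R = "\<lambda>u v. adjacent D u v \<and> v \<notin> S"])
      fix p
      assume p: "p \<noteq> []" "successively (\<lambda>u v. adjacent D u v \<and> v \<notin> S) p"
        "set (tl p) \<inter> S = {}"
      from p(1) obtain x ys where xs: "p = x # ys" by (cases p) auto
      have ys: "successively (\<lambda>u v. adjacent D u v \<and> v \<notin> S) ys"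
        using p(2) xs by (auto simp: successively_Cons)
      have "successively (\<lambda>u v. ?A u v \<and> ?A v u) ys"
        using ys
      proof (rule successively_mono)
        fix u v assume "u \<in> set ys" "v \<in> set ys" "adjacent D u v \<and> v \<notin> S"
        with p(3) xs sym show "?A u v \<and> ?A v u" unfolding adjacent_def by auto
      qed
      then have "successively ?A ys" "successively (\<lambda>u v. ?A v u) ys"
        by (auto elim: successively_mono)
      moreover have "ys = [] \<or> ?A x (hd ys) \<or> ?A (hd ys) x"
        using p(2) xs by (auto simp: successively_Cons adjacent_def)
      ultimately have "successively ?A p \<or> successively (\<lambda>u v. ?A v u) p"
        unfolding xs successively_Cons by blast
      then show "\<exists>q\<in>{p, rev p}. successively ?A q" by simp
    next
      fix u v assume "adjacent D u v"
      with outside[OF this] show "adjacent D u v \<and> v \<notin> S \<or> adjacent D v u \<and> u \<notin> S"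
        unfolding adjacent_def by blast
    qed simp
  qed
qed

theorem corollary7p4:
  fixes D :: "('a, 'b) pre_digraph"
  assumes "digraph D"
    and "semi_symmetric 2 D"
  shows "alpha_diperfect D"
  unfolding alpha_diperfect_def
proof (intro allI impI)
  fix H assume H: "induced_subgraph H D"
  interpret digraph D by (rule assms(1))
  have "digraph H" using H by (rule digraph_subgraph[OF induced_imp_subgraph])
  moreover have "semi_symmetric 2 H"
    using H assms(2) by (rule semi_symmetric_induced_subgraph)
  ultimately show "alpha_property H" by (rule alpha_property_if_semi_symmetric_2)
qed

end
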